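(* Let $n\ge1$ be an integer and $0<\lambda<n$. Then $$L(n,\lambda)^{\lambda/(2n-\lambda)}\,C(n,\lambda)\int_{\mathbb{R}^n}|x|^{-(n-\lambda/2)}(1+|x|^2)^{-\lambda/2}\,dx$$ $$=L(n,\lambda)\,C(n,\lambda)^{\lambda/(2n-\lambda)}\int_{\mathbb{R}^n}|x|^{-\lambda/2}(1+|x|^2)^{-(n-\lambda/2)}\,dx.$$
   Context: Put $p=\frac{2n}{2n-\lambda}$, so $p-1=\frac{\lambda}{2n-\lambda}$. The constant $C(n,\lambda)$ is $$C(n,\lambda)=\left\{\frac{\pi^{n/2}\,\Gamma\left(\frac n2-\frac\lambda2\right)\Gamma\left(\frac\lambda4\right)^2}{\Gamma\left(\frac\lambda2\right)\Gamma\left(\frac n2-\frac\lambda4\right)^2}\right\}^{-\frac{2n-\lambda}{2(n-\lambda)}}.$$ The constant $L(n,\lambda)>0$ is the positive constant (depending only on $n$ and $\lambda$), whose existence is due to Lieb, for which the function $f_L(x)=L(n,\lambda)(1+|x|^2)^{-(n-\lambda/2)}$ satisfies $$\int_{\mathbb{R}^n}|x-y|^{-\lambda}f_L(y)\,dy=f_L(x)^{p-1}\qquad\text{for all }x\in\mathbb{R}^n.$$ *)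

theory Defs
  imports "HOL-Analysis.Analysis"
begin

text \<open>
  Euclidean n-space is \<^typ>\<open>real ^ 'n\<close> with n = \<^term>\<open>CARD('n)\<close>. Integrals are Lebesgue integrals
  with respect to \<^const>\<open>lborel\<close>. Since \<open>0 powr a = 0\<close>, a singular power of the norm has the
  value 0 at its singularity, a null set that no integral below sees.
\<close>

definition p_exp :: "nat \<Rightarrow> real \<Rightarrow> real" where
  "p_exp n lam = 2 * real n / (2 * real n - lam)"

definition C_const :: "nat \<Rightarrow> real \<Rightarrow> real" where
  "C_const n lam =
     (pi powr (real n / 2) * Gamma (real n / 2 - lam / 2) * (Gamma (lam / 4))\<^sup>2
        / (Gamma (lam / 2) * (Gamma (real n / 2 - lam / 4))\<^sup>2))
     powr (- ((2 * real n - lam) / (2 * (real n - lam))))"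

definition lieb_fun :: "real \<Rightarrow> real \<Rightarrow> real ^ 'n \<Rightarrow> real" where
  "lieb_fun L lam x = L * (1 + (norm x)\<^sup>2) powr (- (real CARD('n) - lam / 2))"

text \<open>
  The dimension enters as a type argument; p is \<^const>\<open>p_exp\<close>. The right-hand side of the equation is positive, and
  the integral of a non-integrable function is 0 by convention, so the equation also
  forces the integral on the left to converge. As the two sides scale in L with the
  different exponents 1 and p - 1, at most one positive L satisfies it when 0 < lam < n.
\<close>

definition L_const :: "'n::finite itself \<Rightarrow> real \<Rightarrow> real" where
  "L_const (_ :: 'n::finite itself) lam =
     (THE L. L > 0 \<and>
        (\<forall>x :: real ^ 'n.
           (LINT y|lborel. norm (x - y) powr (- lam) * lieb_fun L lam y)
             = lieb_fun L lam x powr (p_exp CARD('n) lam - 1)))"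

end

theory Submission
  imports Defs "HOL-Probability.Distributions"
begin

text \<open>
  Write \<open>n\<close> for the dimension, \<open>q = lam / (2 n - lam)\<close>, and \<open>I\<close>, \<open>J\<close> for the integrals on the left and
  on the right. Both constants are powers with the same exponent \<open>- 1 / (1 - q)\<close>: the constant C of some
  explicit \<open>D\<close>, by definition, and the constant L of the number \<open>K\<close> in the conformal identity
  \<open>\<integral> |x - y|^{-lam} (1 + |y|\<^sup>2)^{-(n - lam/2)} dy = K (1 + |x|\<^sup>2)^{-lam/2}\<close>,
  since inserting a multiple of \<open>(1 + |x|\<^sup>2) powr - (n - lam / 2)\<close> into Lieb's equation leaves
  \<open>L * K = L powr q\<close>. For such powers the claim amounts to \<open>K * I = D * J\<close>, a comparison of Gamma values.

  What has to be computed is thus \<open>K\<close>, with its identity at every \<open>x\<close>, together with \<open>I\<close> and \<open>J\<close>. All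
  three are cases of \<open>\<integral> |x - y|^{-2a} (1 + |y|\<^sup>2)^{-b} dy\<close>, with \<open>x = 0\<close> for \<open>I\<close> and \<open>J\<close> and with
  \<open>a + b = n\<close> for \<open>K\<close>. Both factors are superpositions of Gaussians, because
  \<open>\<Gamma>(a) c^{-a} = \<integral> t^{a-1} e^{-ct} dt\<close>. Integrating over \<open>y\<close> first, by completing the square, and then over
  the ratio \<open>w\<close> and the size \<open>s\<close> of the two Gaussian parameters leaves one integral over \<open>w > 0\<close>
  (\<open>nn_integral_riesz_mellin\<close>). In both cases of interest its integrand reduces to
  \<open>w^{a-1} (1 + c w)^{-n/2}\<close>, a Beta integral, where \<open>c = 1\<close> or \<open>c = 1 + |x|\<^sup>2\<close>; in the second case scaling
  \<open>c\<close> out produces the factor \<open>(1 + |x|\<^sup>2)^{-a}\<close> and thus the identity.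

  With values in \<^typ>\<open>ennreal\<close>, Tonelli's theorem justifies every exchange of these integrals, and the
  convergence of the original ones follows from the finite values found at the end.
\<close>

section \<open>Gamma, Beta and Gaussian integrals\<close>

text \<open>
  The weight of the Mellin transform at \<open>a\<close>. The indicator is part of it so that every integral runs over
  the whole line, as Tonelli's theorem and affine substitutions want it.
\<close>

definition mellin_weight :: "real \<Rightarrow> real \<Rightarrow> real" where
  "mellin_weight a t = indicator {0<..} t * t powr (a - 1)"

lemma mellin_weight_measurable [measurable]: "mellin_weight a \<in> borel_measurable borel"
  unfolding mellin_weight_def by measurable

lemma mellin_weight_nonneg [simp]: "0 \<le> mellin_weight a t"
  by (simp add: mellin_weight_def)

lemma nn_integral_powr_exp:
  fixes a c :: real
  assumes "0 < a" "0 < c"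
  shows "(\<integral>\<^sup>+t. ennreal (mellin_weight a t * exp (- c * t)) \<partial>lborel)
       = ennreal (Gamma a * c powr (- a))"
proof -
  have "ennreal (Gamma a) = (\<integral>\<^sup>+t. ennreal (indicator {0..} t * t powr (a - 1) / exp t) \<partial>lborel)"
    by (rule Gamma_conv_nn_integral_real) fact
  also have "\<dots> = ennreal c * (\<integral>\<^sup>+t. ennreal (indicator {0..} (0 + c * t) * (0 + c * t) powr (a - 1) / exp (0 + c * t)) \<partial>lborel)"
    using nn_integral_real_affine[of "\<lambda>t. ennreal (indicator {0..} t * t powr (a - 1) / exp t)" c 0] assms
    by simp
  also have "(\<integral>\<^sup>+t. ennreal (indicator {0..} (0 + c * t) * (0 + c * t) powr (a - 1) / exp (0 + c * t)) \<partial>lborel)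
      = (\<integral>\<^sup>+t. ennreal (c powr (a - 1)) * ennreal (mellin_weight a t * exp (- c * t)) \<partial>lborel)"
    using assms by (intro nn_integral_cong)
      (auto simp: mellin_weight_def indicator_def powr_mult exp_minus field_simps zero_le_mult_iff ennreal_mult' [symmetric])
  also have "\<dots> = ennreal (c powr (a - 1)) * (\<integral>\<^sup>+t. ennreal (mellin_weight a t * exp (- c * t)) \<partial>lborel)"
    by (rule nn_integral_cmult) measurable
  finally have "ennreal (c powr (-a)) * ennreal (Gamma a) = ennreal (c powr (-a)) * (ennreal c * (ennreal (c powr (a - 1)) * (\<integral>\<^sup>+t. ennreal (mellin_weight a t * exp (- c * t)) \<partial>lborel)))"
    by simp
  also have "\<dots> = (ennreal (c powr (-a) * c * c powr (a - 1))) * (\<integral>\<^sup>+t. ennreal (mellin_weight a t * exp (- c * t)) \<partial>lborel)"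
    using assms by (simp add: ennreal_mult' mult.assoc)
  also have "c powr (-a) * c * c powr (a - 1) = 1"
    using assms by (simp add: powr_minus powr_diff)
  finally show ?thesis
    using assms by (simp add: ennreal_mult'' [symmetric] mult.commute)
qed

text \<open>The integrand is a multiple of the normal density of variance \<open>1 / (2 c)\<close>.\<close>

lemma nn_integral_gaussian_real:
  fixes c m :: real
  assumes "0 < c"
  shows "(\<integral>\<^sup>+x. ennreal (exp (- c * (x - m)\<^sup>2)) \<partial>lborel) = ennreal (sqrt (pi / c))"
proof -
  define s where "s = sqrt (1 / (2 * c))"
  have s: "0 < s" "s\<^sup>2 = 1 / (2 * c)"
    using assms by (simp_all add: s_def)
  have eq: "exp (- c * (x - m)\<^sup>2) = sqrt (pi / c) * normal_density m s x" for x
    using assms unfolding normal_density_def s(2)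
    by (simp add: real_sqrt_divide field_simps)
  have "(\<integral>\<^sup>+x. ennreal (normal_density m s x) \<partial>lborel) = 1"
    using s by (subst nn_integral_eq_integral) auto
  then show ?thesis
    unfolding eq using assms by (simp add: ennreal_mult' nn_integral_cmult)
qed

lemma nn_integral_gaussian:
  fixes m :: "'a::euclidean_space"
  assumes "0 < c"
  shows "(\<integral>\<^sup>+x. ennreal (exp (- c * (norm (x - m))\<^sup>2)) \<partial>lborel)
       = ennreal ((pi / c) powr (real DIM('a) / 2))"
proof -
  have eq: "exp (- c * (norm (x - m))\<^sup>2) = (\<Prod>b\<in>Basis. exp (- c * (x \<bullet> b - m \<bullet> b)\<^sup>2))" for x
  proof -
    have "(norm (x - m))\<^sup>2 = (\<Sum>b\<in>Basis. (x \<bullet> b - m \<bullet> b)\<^sup>2)"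
      by (subst norm_eq_sqrt_inner, subst euclidean_inner)
        (simp add: sum_nonneg inner_diff_left power2_eq_square)
    then show ?thesis
      by (simp add: exp_sum [symmetric] sum_distrib_left sum_negf)
  qed
  have "(\<integral>\<^sup>+x. ennreal (exp (- c * (norm (x - m))\<^sup>2)) \<partial>lborel)
      = (\<integral>\<^sup>+x. (\<Prod>b\<in>Basis. ennreal (exp (- c * (x \<bullet> b - m \<bullet> b)\<^sup>2))) \<partial>lborel)"
    unfolding eq by (subst prod_ennreal) auto
  also have "\<dots> = (\<Prod>b\<in>(Basis::'a set). \<integral>\<^sup>+x. ennreal (exp (- c * (x - m \<bullet> b)\<^sup>2)) \<partial>lborel)"
    by (rule nn_integral_lborel_prod) auto
  also have "\<dots> = ennreal (sqrt (pi / c) ^ DIM('a))"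
    by (simp only: nn_integral_gaussian_real [OF assms] prod_constant ennreal_power real_sqrt_ge_0_iff
          divide_nonneg_pos pi_ge_zero assms)
  also have "sqrt (pi / c) ^ DIM('a) = (pi / c) powr (real DIM('a) / 2)"
    using assms by (simp add: powr_half_sqrt [symmetric] powr_powr powr_realpow [symmetric])
  finally show ?thesis .
qed

text \<open>
  Expanding \<open>(1 + c w)^{-b}\<close> as a Gamma integral in \<open>r\<close> and integrating over \<open>w\<close> first gives
  \<open>\<Gamma>(a) (c r)^{-a}\<close>; what is left is the Gamma integral with parameter \<open>b - a\<close>.
\<close>

lemma nn_integral_beta_half_line:
  fixes a b c :: real
  assumes "0 < a" "a < b" "0 < c"
  shows "(\<integral>\<^sup>+w. ennreal (mellin_weight a w * (1 + c * w) powr (- b)) \<partial>lborel)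
       = ennreal (c powr (- a) * (Gamma a * Gamma (b - a) / Gamma b))"
proof -
  have G: "0 < Gamma a" "0 < Gamma b" "0 < Gamma (b - a)"
    using assms by (auto intro: Gamma_real_pos)
  have "ennreal (Gamma b) * (\<integral>\<^sup>+w. ennreal (mellin_weight a w * (1 + c * w) powr (- b)) \<partial>lborel)
     = (\<integral>\<^sup>+w. ennreal (mellin_weight a w) * ennreal (Gamma b * (1 + c * w) powr (- b)) \<partial>lborel)"
    using G by (subst nn_integral_cmult [symmetric])
      (auto intro!: nn_integral_cong simp: ennreal_mult' [symmetric] mult_ac)
  also have "\<dots> = (\<integral>\<^sup>+w. \<integral>\<^sup>+r. ennreal (mellin_weight a w) * ennreal (mellin_weight b r * exp (- (1 + c * w) * r)) \<partial>lborel \<partial>lborel)"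
  proof (intro nn_integral_cong)
    fix w :: real
    show "ennreal (mellin_weight a w) * ennreal (Gamma b * (1 + c * w) powr (- b))
      = (\<integral>\<^sup>+r. ennreal (mellin_weight a w) * ennreal (mellin_weight b r * exp (- (1 + c * w) * r)) \<partial>lborel)"
    proof (cases "0 < w")
      case True
      then have "0 < 1 + c * w"
        using assms by (simp add: add_pos_pos)
      then show ?thesis
        using nn_integral_powr_exp[of b "1 + c * w"] assms
        by (simp add: nn_integral_cmult mellin_weight_def)
    qed (simp add: mellin_weight_def)
  qed
  also have "\<dots> = (\<integral>\<^sup>+r. \<integral>\<^sup>+w. ennreal (mellin_weight a w) * ennreal (mellin_weight b r * exp (- (1 + c * w) * r)) \<partial>lborel \<partial>lborel)"
    by (rule lborel_pair.Fubini') measurable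
  also have "\<dots> = (\<integral>\<^sup>+r. ennreal (c powr (- a) * Gamma a) * ennreal (mellin_weight (b - a) r * exp (- 1 * r)) \<partial>lborel)"
  proof (intro nn_integral_cong)
    fix r :: real
    show "(\<integral>\<^sup>+w. ennreal (mellin_weight a w) * ennreal (mellin_weight b r * exp (- (1 + c * w) * r)) \<partial>lborel)
       = ennreal (c powr (- a) * Gamma a) * ennreal (mellin_weight (b - a) r * exp (- 1 * r))"
    proof (cases "0 < r")
      case True
      have "(\<integral>\<^sup>+w. ennreal (mellin_weight a w) * ennreal (mellin_weight b r * exp (- (1 + c * w) * r)) \<partial>lborel)
          = (\<integral>\<^sup>+w. ennreal (mellin_weight b r * exp (- r)) * ennreal (mellin_weight a w * exp (- (c * r) * w)) \<partial>lborel)"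
        by (intro nn_integral_cong) (simp add: ennreal_mult' [symmetric] algebra_simps exp_diff exp_minus field_simps exp_add)
      also have "\<dots> = ennreal (mellin_weight b r * exp (- r)) * ennreal (Gamma a * (c * r) powr (- a))"
        using nn_integral_powr_exp[of a "c * r"] assms True
        by (simp add: nn_integral_cmult mellin_weight_def)
      also have "\<dots> = ennreal (c powr (- a) * Gamma a) * ennreal (mellin_weight (b - a) r * exp (- 1 * r))"
      proof -
        have "r powr (b - 1) * r powr (- a) = r powr (b - a - 1)"
          by (simp add: powr_add [symmetric] algebra_simps)
        then show ?thesis
          using True assms G
          by (simp add: mellin_weight_def powr_mult ennreal_mult' [symmetric] mult_ac)
      qed
      finally show ?thesis .
    qed (simp add: mellin_weight_def)
  qed
  also have "\<dots> = ennreal (c powr (- a) * Gamma a) * ennreal (Gamma (b - a))"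
    using nn_integral_powr_exp[of "b - a" 1] assms by (simp add: nn_integral_cmult mellin_weight_def)
  finally have *: "ennreal (Gamma b) * (\<integral>\<^sup>+w. ennreal (mellin_weight a w * (1 + c * w) powr (- b)) \<partial>lborel)
    = ennreal (c powr (- a) * Gamma a) * ennreal (Gamma (b - a))" .
  have "(\<integral>\<^sup>+w. ennreal (mellin_weight a w * (1 + c * w) powr (- b)) \<partial>lborel)
     = ennreal (1 / Gamma b) * (ennreal (Gamma b) * (\<integral>\<^sup>+w. ennreal (mellin_weight a w * (1 + c * w) powr (- b)) \<partial>lborel))"
    using G by (simp add: mult.assoc [symmetric] ennreal_mult' [symmetric])
  also have "\<dots> = ennreal (c powr (- a) * (Gamma a * Gamma (b - a) / Gamma b))"
    unfolding * using G by (simp add: ennreal_mult' [symmetric] field_simps)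
  finally show ?thesis .
qed

section \<open>The potential of a power of one plus the squared norm\<close>

lemma complete_square_norm:
  fixes x y :: "'a::real_inner"
  assumes "0 < 1 + w"
  shows "(norm y)\<^sup>2 + w * (norm (x - y))\<^sup>2
       = (1 + w) * (norm (y - (w / (1 + w)) *\<^sub>R x))\<^sup>2 + w / (1 + w) * (norm x)\<^sup>2"
proof -
  have *: "(1 + w) * (w / (1 + w)) = w"
    using assms by simp
  define u where "u = w / (1 + w)"
  have u: "u + u * w = w"
    using * by (simp add: u_def [symmetric] algebra_simps)
  have u': "u * u + w * (u * u) = w * u"
    using arg_cong [OF u, of "\<lambda>z. z * u"] by (simp add: algebra_simps)
  have "(norm y)\<^sup>2 + w * (norm (x - y))\<^sup>2
      = (1 + w) * (y \<bullet> y) - 2 * w * (x \<bullet> y) + w * (x \<bullet> x)"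
    by (simp add: power2_norm_eq_inner inner_diff_left inner_diff_right inner_commute algebra_simps)
  also have "\<dots> = (1 + w) * (y \<bullet> y) - 2 * (u + u * w) * (x \<bullet> y) + (u * u + w * (u * u) + u) * (x \<bullet> x)"
    unfolding u' using u by (simp add: algebra_simps)
  also have "\<dots> = (1 + w) * (norm (y - u *\<^sub>R x))\<^sup>2 + u * (norm x)\<^sup>2"
    by (simp add: power2_norm_eq_inner inner_diff_left inner_diff_right inner_commute algebra_simps)
  finally show ?thesis
    by (simp add: u_def)
qed

text \<open>
  With \<open>s\<close> and \<open>t\<close> the Gamma variables of \<open>1 + |y|\<^sup>2\<close> and \<open>|x - y|\<^sup>2\<close>, the substitution \<open>t = s w\<close> makes the
  total Gaussian parameter \<open>s (1 + w)\<close>. The Gaussian integral therefore factors into a power of \<open>s\<close> and one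
  of \<open>1 + w\<close>, and the exponent that remains is linear in \<open>s\<close>, so \<open>s\<close> can be integrated out.
\<close>

lemma nn_integral_riesz_mellin:
  fixes x :: "'a::euclidean_space" and a b :: real
  defines "h \<equiv> real DIM('a) / 2"
  assumes a: "0 < a" and b: "0 < b" and ab: "h < a + b"
  shows "(\<integral>\<^sup>+y. ennreal (norm (x - y) powr (- (2 * a)) * (1 + (norm y)\<^sup>2) powr (- b)) \<partial>lborel)
       = ennreal (pi powr h * Gamma (a + b - h) / (Gamma a * Gamma b))
           * (\<integral>\<^sup>+w. ennreal (mellin_weight a w
               * ((1 + w) powr (- h) * (1 + w / (1 + w) * (norm x)\<^sup>2) powr (- (a + b - h)))) \<partial>lborel)"
proof -
  define f where "f y = norm (x - y) powr (- (2 * a)) * (1 + (norm y)\<^sup>2) powr (- b)" for y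
  define \<phi> where "\<phi> s t y = mellin_weight b s * exp (- (1 + (norm y)\<^sup>2) * s)
      * (mellin_weight a t * exp (- (norm (x - y))\<^sup>2 * t))" for s t and y :: 'a
  have [measurable]: "f \<in> borel_measurable borel"
    unfolding f_def by measurable
  have G: "0 < Gamma a" "0 < Gamma b" "0 < Gamma (a + b - h)"
    using a b ab by (auto intro: Gamma_real_pos)
  have "ennreal (Gamma a * Gamma b) * (\<integral>\<^sup>+y. ennreal (f y) \<partial>lborel)
      = (\<integral>\<^sup>+y. ennreal (Gamma a * Gamma b) * ennreal (f y) \<partial>lborel)"
    by (rule nn_integral_cmult [symmetric]) measurable
  also have "\<dots> = (\<integral>\<^sup>+y. \<integral>\<^sup>+s. \<integral>\<^sup>+t. ennreal (\<phi> s t y) \<partial>lborel \<partial>lborel \<partial>lborel)"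
    \<comment> \<open>At \<open>y = x\<close> the power of the norm is 0, whereas its Gamma integral diverges.\<close>
  proof (rule nn_integral_cong_AE)
    have "ennreal (Gamma a * Gamma b) * ennreal (f y)
        = (\<integral>\<^sup>+s. \<integral>\<^sup>+t. ennreal (\<phi> s t y) \<partial>lborel \<partial>lborel)" if "y \<noteq> x" for y
    proof -
      have "0 < 1 + (norm y)\<^sup>2"
        by (simp add: add_pos_nonneg)
      have "norm (x - y) powr (- (2 * a)) = (norm (x - y))\<^sup>2 powr (- a)"
        using that by (simp add: powr_powr flip: powr_numeral)
      then have "ennreal (Gamma a * Gamma b) * ennreal (f y)
        = ennreal (Gamma b * (1 + (norm y)\<^sup>2) powr (- b)) * ennreal (Gamma a * (norm (x - y))\<^sup>2 powr (- a))"
        using G by (simp add: f_def ennreal_mult' [symmetric] mult_ac)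
      also have "\<dots> = (\<integral>\<^sup>+s. ennreal (mellin_weight b s * exp (- (1 + (norm y)\<^sup>2) * s)) \<partial>lborel)
          * (\<integral>\<^sup>+t. ennreal (mellin_weight a t * exp (- (norm (x - y))\<^sup>2 * t)) \<partial>lborel)"
        using nn_integral_powr_exp[OF b \<open>0 < 1 + (norm y)\<^sup>2\<close>] nn_integral_powr_exp[OF a, of "(norm (x - y))\<^sup>2"] that
        by simp
      also have "\<dots> = (\<integral>\<^sup>+s. \<integral>\<^sup>+t. ennreal (\<phi> s t y) \<partial>lborel \<partial>lborel)"
        unfolding \<phi>_def by (simp add: nn_integral_cmult nn_integral_multc ennreal_mult')
      finally show ?thesis .
    qed
    then show "AE y in lborel. ennreal (Gamma a * Gamma b) * ennreal (f y)
        = (\<integral>\<^sup>+s. \<integral>\<^sup>+t. ennreal (\<phi> s t y) \<partial>lborel \<partial>lborel)"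
      using AE_lborel_singleton[of x] by (auto elim: eventually_mono)
  qed
  also have "\<dots> = (\<integral>\<^sup>+s. \<integral>\<^sup>+y. \<integral>\<^sup>+t. ennreal (\<phi> s t y) \<partial>lborel \<partial>lborel \<partial>lborel)"
    unfolding \<phi>_def by (rule lborel_pair.Fubini') measurable
  also have "\<dots> = (\<integral>\<^sup>+s. \<integral>\<^sup>+t. \<integral>\<^sup>+y. ennreal (\<phi> s t y) \<partial>lborel \<partial>lborel \<partial>lborel)"
    unfolding \<phi>_def by (intro nn_integral_cong lborel_pair.Fubini') measurable
  also have "\<dots> = (\<integral>\<^sup>+s. \<integral>\<^sup>+w. ennreal (pi powr h) * ennreal (mellin_weight a w * (1 + w) powr (- h))
      * ennreal (mellin_weight (a + b - h) s * exp (- (1 + w / (1 + w) * (norm x)\<^sup>2) * s)) \<partial>lborel \<partial>lborel)"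
  proof (rule nn_integral_cong)
    fix s :: real
    show "(\<integral>\<^sup>+t. \<integral>\<^sup>+y. ennreal (\<phi> s t y) \<partial>lborel \<partial>lborel)
      = (\<integral>\<^sup>+w. ennreal (pi powr h) * ennreal (mellin_weight a w * (1 + w) powr (- h))
          * ennreal (mellin_weight (a + b - h) s * exp (- (1 + w / (1 + w) * (norm x)\<^sup>2) * s)) \<partial>lborel)"
    proof (cases "0 < s")
      case True
      have "(\<integral>\<^sup>+t. \<integral>\<^sup>+y. ennreal (\<phi> s t y) \<partial>lborel \<partial>lborel)
          = ennreal \<bar>s\<bar> * (\<integral>\<^sup>+w. \<integral>\<^sup>+y. ennreal (\<phi> s (0 + s * w) y) \<partial>lborel \<partial>lborel)"
        using True unfolding \<phi>_def by (intro nn_integral_real_affine) measurable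
      also have "\<dots> = (\<integral>\<^sup>+w. ennreal s * (\<integral>\<^sup>+y. ennreal (\<phi> s (s * w) y) \<partial>lborel) \<partial>lborel)"
        using True unfolding \<phi>_def by (subst nn_integral_cmult) auto
      also have "\<dots> = (\<integral>\<^sup>+w. ennreal (pi powr h) * ennreal (mellin_weight a w * (1 + w) powr (- h))
          * ennreal (mellin_weight (a + b - h) s * exp (- (1 + w / (1 + w) * (norm x)\<^sup>2) * s)) \<partial>lborel)"
      proof (intro nn_integral_cong)
        fix w :: real
        show "ennreal s * (\<integral>\<^sup>+y. ennreal (\<phi> s (s * w) y) \<partial>lborel)
          = ennreal (pi powr h) * ennreal (mellin_weight a w * (1 + w) powr (- h))
            * ennreal (mellin_weight (a + b - h) s * exp (- (1 + w / (1 + w) * (norm x)\<^sup>2) * s))"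
        proof (cases "0 < w")
          case w: True
          define m where "m = (w / (1 + w)) *\<^sub>R x"
          define E where "E = exp (- (1 + w / (1 + w) * (norm x)\<^sup>2) * s)"
          have "\<phi> s (s * w) y = mellin_weight b s * mellin_weight a (s * w) * E
              * exp (- (s * (1 + w)) * (norm (y - m))\<^sup>2)" for y
          proof -
            have "exp (- (1 + (norm y)\<^sup>2) * s) * exp (- (norm (x - y))\<^sup>2 * (s * w))
               = exp (- s * (1 + ((norm y)\<^sup>2 + w * (norm (x - y))\<^sup>2)))"
              by (simp add: exp_add [symmetric] algebra_simps)
            also have "\<dots> = E * exp (- (s * (1 + w)) * (norm (y - m))\<^sup>2)"
              using w unfolding E_def exp_add [symmetric]
              by (subst complete_square_norm) (simp_all add: m_def algebra_simps)
            finally show ?thesis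
              by (simp add: \<phi>_def)
          qed
          then have "ennreal s * (\<integral>\<^sup>+y. ennreal (\<phi> s (s * w) y) \<partial>lborel)
            = ennreal s * (ennreal (mellin_weight b s * mellin_weight a (s * w) * E)
                * (\<integral>\<^sup>+y. ennreal (exp (- (s * (1 + w)) * (norm (y - m))\<^sup>2)) \<partial>lborel))"
            by (simp add: E_def ennreal_mult' nn_integral_cmult)
          also have "\<dots> = ennreal (s * mellin_weight b s * mellin_weight a (s * w) * E
              * (pi / (s * (1 + w))) powr h)"
            using True w nn_integral_gaussian[of "s * (1 + w)" m]
            by (simp add: h_def E_def ennreal_mult' [symmetric] mult.assoc)
          also have "s * mellin_weight b s * mellin_weight a (s * w) * E * (pi / (s * (1 + w))) powr h
            = pi powr h * (mellin_weight a w * (1 + w) powr (- h)) * (mellin_weight (a + b - h) s * E)"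
          proof -
            \<comment> \<open>The first factor \<open>s\<close> is the Jacobian of \<open>t = s w\<close>.\<close>
            have "s * s powr (b - 1) * s powr (a - 1) * s powr (- h) = s powr (a + b - h - 1)"
              using True by (simp add: powr_add [symmetric] powr_mult_base algebra_simps)
            moreover have "(pi / (s * (1 + w))) powr h = pi powr h * (s powr (- h) * (1 + w) powr (- h))"
              using True w by (simp add: powr_divide powr_mult powr_minus_divide)
            moreover have "mellin_weight a (s * w) = s powr (a - 1) * w powr (a - 1)"
              using True w by (simp add: mellin_weight_def powr_mult)
            ultimately show ?thesis
              using True w by (simp add: mellin_weight_def mult_ac)
          qed
          finally show ?thesis
            by (simp add: E_def ennreal_mult')
        qed (use True in \<open>simp add: \<phi>_def mellin_weight_def zero_less_mult_iff\<close>)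
      qed
      finally show ?thesis .
    qed (simp add: \<phi>_def mellin_weight_def)
  qed
  also have "\<dots> = (\<integral>\<^sup>+w. \<integral>\<^sup>+s. ennreal (pi powr h) * ennreal (mellin_weight a w * (1 + w) powr (- h))
      * ennreal (mellin_weight (a + b - h) s * exp (- (1 + w / (1 + w) * (norm x)\<^sup>2) * s)) \<partial>lborel \<partial>lborel)"
    by (rule lborel_pair.Fubini') measurable
  also have "\<dots> = (\<integral>\<^sup>+w. ennreal (pi powr h * Gamma (a + b - h)) * ennreal (mellin_weight a w
      * ((1 + w) powr (- h) * (1 + w / (1 + w) * (norm x)\<^sup>2) powr (- (a + b - h)))) \<partial>lborel)"
  proof (intro nn_integral_cong)
    fix w :: real
    show "(\<integral>\<^sup>+s. ennreal (pi powr h) * ennreal (mellin_weight a w * (1 + w) powr (- h))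
        * ennreal (mellin_weight (a + b - h) s * exp (- (1 + w / (1 + w) * (norm x)\<^sup>2) * s)) \<partial>lborel)
      = ennreal (pi powr h * Gamma (a + b - h)) * ennreal (mellin_weight a w
        * ((1 + w) powr (- h) * (1 + w / (1 + w) * (norm x)\<^sup>2) powr (- (a + b - h))))"
    proof (cases "0 < w")
      case True
      then have "0 < 1 + w / (1 + w) * (norm x)\<^sup>2"
        by (intro add_pos_nonneg) auto
      then have "(\<integral>\<^sup>+s. ennreal (mellin_weight (a + b - h) s * exp (- (1 + w / (1 + w) * (norm x)\<^sup>2) * s)) \<partial>lborel)
        = ennreal (Gamma (a + b - h) * (1 + w / (1 + w) * (norm x)\<^sup>2) powr (- (a + b - h)))"
        using ab by (intro nn_integral_powr_exp) auto
      then show ?thesis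
        using G by (subst nn_integral_cmult) (simp_all add: ennreal_mult' [symmetric] mult_ac)
    qed (simp add: mellin_weight_def)
  qed
  also have "\<dots> = ennreal (pi powr h * Gamma (a + b - h)) * (\<integral>\<^sup>+w. ennreal (mellin_weight a w
      * ((1 + w) powr (- h) * (1 + w / (1 + w) * (norm x)\<^sup>2) powr (- (a + b - h)))) \<partial>lborel)"
    by (rule nn_integral_cmult) measurable
  finally have *: "ennreal (Gamma a * Gamma b) * (\<integral>\<^sup>+y. ennreal (f y) \<partial>lborel) = \<dots>" .
  have "(\<integral>\<^sup>+y. ennreal (f y) \<partial>lborel)
      = ennreal (1 / (Gamma a * Gamma b)) * (ennreal (Gamma a * Gamma b) * (\<integral>\<^sup>+y. ennreal (f y) \<partial>lborel))"
    using G by (simp add: mult.assoc [symmetric] ennreal_mult' [symmetric])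
  then show ?thesis
    unfolding * using G
    by (simp add: f_def mult.assoc [symmetric] ennreal_mult' [symmetric])
qed

lemma integral_norm_powr:
  fixes a b :: real
  defines "h \<equiv> real DIM('a::euclidean_space) / 2"
  assumes a: "0 < a" "a < h" and b: "0 < b" "h < a + b"
  shows "(LINT x::'a|lborel. norm x powr (- (2 * a)) * (1 + (norm x)\<^sup>2) powr (- b))
       = pi powr h * Gamma (h - a) * Gamma (a + b - h) / (Gamma h * Gamma b)"
proof -
  have G: "0 < Gamma a" "0 < Gamma b" "0 < Gamma h" "0 < Gamma (h - a)" "0 < Gamma (a + b - h)"
    using a b by (auto intro: Gamma_real_pos)
  have "(\<integral>\<^sup>+x. ennreal (norm (x::'a) powr (- (2 * a)) * (1 + (norm x)\<^sup>2) powr (- b)) \<partial>lborel)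
    = ennreal (pi powr h * Gamma (a + b - h) / (Gamma a * Gamma b))
        * (\<integral>\<^sup>+w. ennreal (mellin_weight a w * (1 + 1 * w) powr (- h)) \<partial>lborel)"
    using nn_integral_riesz_mellin[of a b "0::'a", folded h_def] a b by simp
  also have "\<dots> = ennreal (pi powr h * Gamma (h - a) * Gamma (a + b - h) / (Gamma h * Gamma b))"
    unfolding nn_integral_beta_half_line [OF a zero_less_one]
    using G by (simp add: ennreal_mult' [symmetric] mult_ac)
  finally show ?thesis
    using G by (subst integral_eq_nn_integral) auto
qed

text \<open>
  The condition on \<open>a + b\<close> makes the two powers in \<open>nn_integral_riesz_mellin\<close> have equal exponents, so
  their bases multiply to \<open>1 + (1 + |x|\<^sup>2) w\<close>, and \<open>x\<close> enters only through the scale of \<open>w\<close>.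
\<close>

lemma integral_riesz_conformal:
  fixes x :: "'a::euclidean_space" and a b :: real
  defines "h \<equiv> real DIM('a) / 2"
  assumes a: "0 < a" "a < h" and ab: "a + b = 2 * h"
  shows "(LINT y|lborel. norm (x - y) powr (- (2 * a)) * (1 + (norm y)\<^sup>2) powr (- b))
       = pi powr h * Gamma (h - a) / Gamma b * (1 + (norm x)\<^sup>2) powr (- a)"
proof -
  have b: "0 < b" and h: "a + b - h = h"
    using a ab by auto
  have G: "0 < Gamma a" "0 < Gamma b" "0 < Gamma h" "0 < Gamma (h - a)"
    using a b by (auto intro: Gamma_real_pos)
  have X: "0 < 1 + (norm x)\<^sup>2"
    by (simp add: add_pos_nonneg)
  have eq: "mellin_weight a w * ((1 + w) powr (- h) * (1 + w / (1 + w) * (norm x)\<^sup>2) powr (- h))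
      = mellin_weight a w * (1 + (1 + (norm x)\<^sup>2) * w) powr (- h)" for w
  proof (cases "0 < w")
    case True
    then have "(1 + w) * (1 + w / (1 + w) * (norm x)\<^sup>2) = 1 + (1 + (norm x)\<^sup>2) * w"
      by (simp add: distrib_left) (simp add: algebra_simps)
    moreover have "0 \<le> 1 + w / (1 + w) * (norm x)\<^sup>2"
      using True by simp
    ultimately show ?thesis
      using True by (simp add: powr_mult [symmetric])
  qed (simp add: mellin_weight_def)
  have "(\<integral>\<^sup>+y. ennreal (norm (x - y) powr (- (2 * a)) * (1 + (norm y)\<^sup>2) powr (- b)) \<partial>lborel)
    = ennreal (pi powr h * Gamma h / (Gamma a * Gamma b))
        * (\<integral>\<^sup>+w. ennreal (mellin_weight a w * (1 + (1 + (norm x)\<^sup>2) * w) powr (- h)) \<partial>lborel)"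
    using nn_integral_riesz_mellin[of a b x, folded h_def] a b ab unfolding h eq by simp
  also have "\<dots> = ennreal (pi powr h * Gamma (h - a) / Gamma b * (1 + (norm x)\<^sup>2) powr (- a))"
    unfolding nn_integral_beta_half_line [OF a X]
    using G by (simp add: ennreal_mult' [symmetric] mult_ac)
  finally show ?thesis
    using G by (subst integral_eq_nn_integral) auto
qed

section \<open>Lieb's constant and the comparison of the two products\<close>

text \<open>
  By the conformal identity both sides of Lieb's equation are multiples of \<open>(1 + |x|\<^sup>2) powr - (lam / 2)\<close>,
  so that the equation is the scalar condition \<open>L * K = L powr q\<close>. Its solution is unique among positive
  numbers because \<open>q \<noteq> 1\<close>.
\<close>

lemma L_const_eq:
  assumes lam: "0 < lam" "lam < real CARD('n::finite)"
  shows "L_const TYPE('n) lam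
       = (pi powr (real CARD('n) / 2) * Gamma (real CARD('n) / 2 - lam / 2)
            / Gamma (real CARD('n) - lam / 2))
         powr (- ((2 * real CARD('n) - lam) / (2 * (real CARD('n) - lam))))"
proof -
  define n where "n = real CARD('n)"
  define K where "K = pi powr (n / 2) * Gamma (n / 2 - lam / 2) / Gamma (n - lam / 2)"
  define q where "q = lam / (2 * n - lam)"
  have n: "0 < lam" "lam < n"
    using lam by (simp_all add: n_def)
  have q: "p_exp CARD('n) lam - 1 = q" "(n - lam / 2) * q = lam / 2" "0 < q" "q < 1"
    "1 / (1 - q) = (2 * n - lam) / (2 * (n - lam))"
    using n by (simp_all add: p_exp_def q_def n_def [symmetric] field_simps)
  have K: "0 < K"
    unfolding K_def using n by (intro divide_pos_pos mult_pos_pos Gamma_real_pos) auto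
  have lhs: "(LINT y|lborel. norm (x - y) powr (- lam) * lieb_fun L lam y)
      = L * (K * (1 + (norm x)\<^sup>2) powr (- (lam / 2)))" for x :: "real ^ 'n" and L
  proof -
    have "(LINT y|lborel. norm (x - y) powr (- lam) * lieb_fun L lam y)
      = (LINT y|lborel. L * (norm (x - y) powr (- (2 * (lam / 2))) * (1 + (norm y)\<^sup>2) powr (- (n - lam / 2))))"
      by (intro Bochner_Integration.integral_cong) (simp_all add: lieb_fun_def n_def)
    also have "\<dots> = L * (K * (1 + (norm x)\<^sup>2) powr (- (lam / 2)))"
      using integral_riesz_conformal[of "lam / 2" "n - lam / 2" x] n
      by (simp add: K_def n_def)
    finally show ?thesis .
  qed
  have rhs: "lieb_fun L lam x powr (p_exp CARD('n) lam - 1)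
      = L powr q * (1 + (norm x)\<^sup>2) powr (- (lam / 2))" if "0 < L" for x :: "real ^ 'n" and L
    using that by (simp add: lieb_fun_def n_def [symmetric] powr_mult powr_powr q(1) mult_minus_left q(2)
        del: minus_diff_eq)
  have iff: "(\<forall>x :: real ^ 'n. (LINT y|lborel. norm (x - y) powr (- lam) * lieb_fun L lam y)
      = lieb_fun L lam x powr (p_exp CARD('n) lam - 1)) \<longleftrightarrow> L * K = L powr q" if "0 < L" for L
  proof -
    have "0 < (1 + (norm x)\<^sup>2) powr (- (lam / 2))" for x :: "real ^ 'n"
      using add_pos_nonneg [OF zero_less_one, of "(norm x)\<^sup>2"] by simp
    then show ?thesis
      unfolding lhs rhs [OF that] mult.assoc [symmetric]
      by (metis less_irrefl mult_cancel_right)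
  qed
  have sol: "L * K = L powr q \<longleftrightarrow> L = K powr (- (1 / (1 - q)))" if "0 < L" for L
  proof -
    have "L * K = L powr q \<longleftrightarrow> ln (L * K) = ln (L powr q)"
      by (intro ln_inj_iff [symmetric] mult_pos_pos that K) (use that in simp)
    also have "\<dots> \<longleftrightarrow> ln L = - (1 / (1 - q)) * ln K"
      using that K q by (simp add: ln_mult ln_powr field_simps)
    also have "\<dots> \<longleftrightarrow> ln L = ln (K powr (- (1 / (1 - q))))"
      by (simp add: ln_powr)
    also have "\<dots> \<longleftrightarrow> L = K powr (- (1 / (1 - q)))"
      by (intro ln_inj_iff that) (use K in simp)
    finally show ?thesis .
  qed
  have "L_const TYPE('n) lam = K powr (- (1 / (1 - q)))"
    unfolding L_const_def
  proof (rule the_equality)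
    show "K powr (- (1 / (1 - q))) > 0 \<and> (\<forall>x :: real ^ 'n.
        (LINT y|lborel. norm (x - y) powr (- lam) * lieb_fun (K powr (- (1 / (1 - q)))) lam y)
          = lieb_fun (K powr (- (1 / (1 - q)))) lam x powr (p_exp CARD('n) lam - 1))"
      using iff[of "K powr (- (1 / (1 - q)))"] sol[of "K powr (- (1 / (1 - q)))"] K by simp
  qed (use iff sol in blast)
  then show ?thesis
    by (simp only: K_def q(5) n_def)
qed

text \<open>
  The exponent is chosen so that raising \<open>z powr r\<close> to the power \<open>q\<close> multiplies it by \<open>z\<close>; both sides then
  contain \<open>A powr r * B powr r\<close>.
\<close>

lemma powr_conjugate_identity:
  fixes A B I J q :: real
  assumes "0 < A" "0 < B" "q \<noteq> 1" "A * I = B * J"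
  defines "r \<equiv> - (1 / (1 - q))"
  shows "(A powr r) powr q * B powr r * I = A powr r * (B powr r) powr q * J"
proof -
  have "r * q = r + 1"
    using assms(3) by (simp add: r_def field_simps)
  then have pow: "(z powr r) powr q = z powr r * z" if "0 < z" for z
    using that by (simp add: powr_powr powr_add)
  show ?thesis
    using assms(4) by (simp add: pow assms(1,2) mult_ac)
qed

theorem corollary1p3:
  fixes lam :: real
  assumes "0 < lam" and "lam < real CARD('n::finite)"
  shows "L_const TYPE('n) lam powr (lam / (2 * real CARD('n) - lam)) * C_const CARD('n) lam
           * (LINT x::real^'n|lborel. norm x powr (- (real CARD('n) - lam / 2))
                * (1 + (norm x)\<^sup>2) powr (- (lam / 2)))
       = L_const TYPE('n) lam * C_const CARD('n) lam powr (lam / (2 * real CARD('n) - lam))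
           * (LINT x::real^'n|lborel. norm x powr (- (lam / 2))
                * (1 + (norm x)\<^sup>2) powr (- (real CARD('n) - lam / 2)))"
proof -
  define n where "n = real CARD('n)"
  define K where "K = pi powr (n / 2) * Gamma (n / 2 - lam / 2) / Gamma (n - lam / 2)"
  define D where "D = pi powr (n / 2) * Gamma (n / 2 - lam / 2) * (Gamma (lam / 4))\<^sup>2
    / (Gamma (lam / 2) * (Gamma (n / 2 - lam / 4))\<^sup>2)"
  define q where "q = lam / (2 * n - lam)"
  define I where "I = (LINT x::real^'n|lborel. norm x powr (- (n - lam / 2))
                * (1 + (norm x)\<^sup>2) powr (- (lam / 2)))"
  define J where "J = (LINT x::real^'n|lborel. norm x powr (- (lam / 2))
                * (1 + (norm x)\<^sup>2) powr (- (n - lam / 2)))"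
  have n: "0 < lam" "lam < n"
    using assms by (simp_all add: n_def)
  have q: "q \<noteq> 1" "(2 * n - lam) / (2 * (n - lam)) = 1 / (1 - q)"
    using n by (simp_all add: q_def field_simps)
  have L: "L_const TYPE('n) lam = K powr (- (1 / (1 - q)))"
    unfolding q(2) [symmetric] K_def n_def by (rule L_const_eq) fact+
  have C: "C_const CARD('n) lam = D powr (- (1 / (1 - q)))"
    unfolding q(2) [symmetric] C_const_def D_def n_def ..
  have G: "0 < Gamma (lam / 4)" "0 < Gamma (lam / 2)" "0 < Gamma (n / 2)" "0 < Gamma (n / 2 - lam / 2)"
    "0 < Gamma (n / 2 - lam / 4)" "0 < Gamma (n - lam / 2)"
    using n by (auto intro!: Gamma_real_pos)
  have KD: "0 < K" "0 < D"
    using G by (simp_all add: K_def D_def)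
  have "2 * (n / 2 - lam / 4) = n - lam / 2" "n / 2 - (n / 2 - lam / 4) = lam / 4"
    "n / 2 - lam / 4 + lam / 2 - n / 2 = lam / 4"
    by simp_all
  then have I_eq: "I = pi powr (n / 2) * (Gamma (lam / 4))\<^sup>2 / (Gamma (n / 2) * Gamma (lam / 2))"
    using integral_norm_powr[where 'a = "real ^ 'n", of "n / 2 - lam / 4" "lam / 2"] n
    by (simp add: I_def n_def [symmetric] power2_eq_square)
  have "2 * (lam / 4) = lam / 2" "lam / 4 + (n - lam / 2) - n / 2 = n / 2 - lam / 4"
    by simp_all
  then have J_eq: "J = pi powr (n / 2) * (Gamma (n / 2 - lam / 4))\<^sup>2 / (Gamma (n / 2) * Gamma (n - lam / 2))"
    using integral_norm_powr[where 'a = "real ^ 'n", of "lam / 4" "n - lam / 2"] n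
    by (simp add: J_def n_def [symmetric] power2_eq_square)
  have "K * I = D * J"
    unfolding I_eq J_eq K_def D_def using G by (simp add: mult_ac)
  from powr_conjugate_identity [OF KD q(1) this] show ?thesis
    unfolding L C I_def J_def n_def q_def .
qed

end
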